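(* Let $u=(u_i)_{i\in\mathbb Z}$ be a real sequence with only finitely many nonzero terms such that $\sup_i(u_i+u_{i+1})\ge 1$ (case (C2)), and let $k=1$. If $u$ contains just one soliton $(l,\ldots,l+s)$, then the pair of fundamental eigenvectors $\Phi^{(1)},\Phi^{(2)}$ associated with it satisfies, for a suitable value of the parameter $\sigma\in\mathbb R$, for all $i\in\mathbb Z$: $$\Phi^{(1)}_i=\max\bigl(\Phi^{(2)}_{i+1},\ \Phi^{(1)}_{i+1}+u_i-1\bigr),\qquad \Phi^{(2)}_{i+1}=\max\bigl(\Phi^{(1)}_i-\sigma,\ \Phi^{(2)}_i+u_i+k-1\bigr).$$
   Context: Max-plus conventions: on $\mathbb R\cup\{-\infty\}$, $a\oplus b=\max(a,b)$, $a\otimes b=a+b$, extended to matrices and vectors in the usual way. Put $\gamma_i=\min(u_i,1-u_{i-1})$ and $\delta_i=\min(u_{i-1},1-u_i)$. The $\mathbb Z\times\mathbb Z$ matrix $A(\gamma)$ has entries $A(\gamma)_{i,i+1}=\gamma_i-k$, $A(\gamma)_{i,i-1}=\gamma_i$, and all other entries $-\infty$; $A(\delta)$ is defined in the same way with $\delta_i$ in place of $\gamma_i$. Soliton in case (C2) (with $s\ge1$): a sequence of indices $(l,\ldots,l+s)$ such that $u_l+u_{l+1}\ge 1,\ldots,u_{l+s-1}+u_{l+s}\ge 1$ while $u_{l-1}+u_l<1$ and $u_{l+s}+u_{l+s+1}<1$. For $A$ equal to $A(\gamma)$ or $A(\delta)$, the Kleene star is $A^*=I\oplus A\oplus A^2\oplus\cdots$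 ($I$ has $0$ on the diagonal and $-\infty$ elsewhere); $A^*_{ij}$, $i\neq j$, is the greatest weight (sum of entries) of a path from $i$ to $j$ in the digraph on $\mathbb Z$ with edges $(i,j)$, $A_{ij}\ne-\infty$. The critical graph of $A$ consists of the nodes and edges of the two-cycles of greatest total weight. The pair of fundamental eigenvectors associated with the soliton $(l,\ldots,l+s)$: $\Phi^{(1)}$ is column $l$ of $A(\gamma)^*$ (the two-cycle on $l,l+1$ is critical for $A(\gamma)$) and $\Phi^{(2)}$ is column $l+s$ of $A(\delta)^*$ (the two-cycle on $l+s,l+s+1$ is critical for $A(\delta)$), each shifted by an additive constant so that $\Phi^{(1)}_i=\Phi^{(2)}_i=0$ for all sufficiently large $i$. *)

theory Defs
  imports "HOL-Library.Extended_Real"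
begin

(* The max-plus semiring R \<union> {-\<infinity>} lives inside ereal: its sum is max (SUP when
   infinitely many terms are involved), its product is +. The value \<infinity> is there only to
   make every supremum exist; no matrix entry below is \<infinity>. *)

type_synonym mp_vector = "int \<Rightarrow> ereal"
type_synonym mp_matrix = "int \<Rightarrow> int \<Rightarrow> ereal"

definition mp_id :: mp_matrix where
  "mp_id i j = (if i = j then 0 else -\<infinity>)"

definition mp_mult :: "mp_matrix \<Rightarrow> mp_matrix \<Rightarrow> mp_matrix" where
  "mp_mult A B i j = (SUP m. A i m + B m j)"

primrec mp_power :: "mp_matrix \<Rightarrow> nat \<Rightarrow> mp_matrix" where
  "mp_power A 0 = mp_id"
| "mp_power A (Suc n) = mp_mult A (mp_power A n)"

definition kleene_star :: "mp_matrix \<Rightarrow> mp_matrix" where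
  "kleene_star A i j = (SUP n. mp_power A n i j)"

definition gam :: "(int \<Rightarrow> real) \<Rightarrow> int \<Rightarrow> real" where
  "gam u i = min (u i) (1 - u (i - 1))"

definition del :: "(int \<Rightarrow> real) \<Rightarrow> int \<Rightarrow> real" where
  "del u i = min (u (i - 1)) (1 - u i)"

definition A_mat :: "real \<Rightarrow> (int \<Rightarrow> real) \<Rightarrow> mp_matrix" where
  "A_mat k g i j =
     (if j = i + 1 then ereal (g i - k) else if j = i - 1 then ereal (g i) else -\<infinity>)"

(* Case (C2). For u of finite support the supremum is over a bounded (in fact finite) set
   of values, so the real-valued SUP is the genuine one. *)
definition case_C2 :: "(int \<Rightarrow> real) \<Rightarrow> bool" where
  "case_C2 u \<longleftrightarrow> (SUP i. u i + u (i + 1)) \<ge> 1"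

(* (l, ..., l + s) is a soliton of u in case (C2). *)
definition soliton :: "(int \<Rightarrow> real) \<Rightarrow> int \<Rightarrow> nat \<Rightarrow> bool" where
  "soliton u l s \<longleftrightarrow> s \<ge> 1 \<and>
     (\<forall>j<s. u (l + int j) + u (l + int j + 1) \<ge> 1) \<and>
     u (l - 1) + u l < 1 \<and> u (l + int s) + u (l + int s + 1) < 1"

(* The additive shift of v by a real constant that vanishes for all sufficiently large
   indices. There is at most one (see shift_to_zero_eqI). *)
definition shift_to_zero :: "mp_vector \<Rightarrow> mp_vector" where
  "shift_to_zero v =
     (THE w. (\<exists>c::real. \<forall>i. w i = v i + ereal c) \<and> (\<exists>N. \<forall>i\<ge>N. w i = 0))"

lemma shift_to_zero_eqI:
  fixes c :: real
  assumes c: "\<And>i. w i = v i + ereal c" and N: "\<And>i. i \<ge> N \<Longrightarrow> w i = 0"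
  shows "shift_to_zero v = w"
  unfolding shift_to_zero_def
proof (rule the_equality)
  show "(\<exists>c::real. \<forall>i. w i = v i + ereal c) \<and> (\<exists>N. \<forall>i\<ge>N. w i = 0)"
    using assms by blast
next
  fix w'
  assume "(\<exists>c::real. \<forall>i. w' i = v i + ereal c) \<and> (\<exists>N. \<forall>i\<ge>N. w' i = 0)"
  then obtain c' :: real and N'
    where c': "\<And>i. w' i = v i + ereal c'" and N': "\<And>i. i \<ge> N' \<Longrightarrow> w' i = 0"
    by blast
  define m where "m = max N N'"
  have "v m + ereal c = 0" "v m + ereal c' = 0"
    using c[of m] N[of m] c'[of m] N'[of m] by (auto simp: m_def)
  then have "c = c'" by (cases "v m") auto
  then show "w' = w" using c c' by auto
qed

(* The pair of fundamental eigenvectors associated with the soliton (l, ..., l + s). *)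
definition Phi1 :: "real \<Rightarrow> (int \<Rightarrow> real) \<Rightarrow> int \<Rightarrow> mp_vector" where
  "Phi1 k u l = shift_to_zero (\<lambda>i. kleene_star (A_mat k (gam u)) i l)"

definition Phi2 :: "real \<Rightarrow> (int \<Rightarrow> real) \<Rightarrow> int \<Rightarrow> nat \<Rightarrow> mp_vector" where
  "Phi2 k u l s = shift_to_zero (\<lambda>i. kleene_star (A_mat k (del u)) i (l + int s))"

end

(* Every two-cycle of A(gamma) and A(delta) has weight at most 0, so the heaviest path between
   two nodes is the straight one. Hence P = Phi1 and Q = Phi2 have explicit increments:
   with r = l + s, P(i+1) - P(i) is gamma(i+1) for i >= l and 1 - gamma(i) for i < l, and
   similarly for Q with delta and r in place of gamma and l. As (l, ..., r) is the only soliton,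
   u(i) + u(i+1) >= 1 holds exactly for l <= i < r, which resolves all minima in gamma and delta.
   Then the difference D(i) = Q(i+1) - P(i) is constant for i <= l, nondecreasing for l <= i <= r,
   and 0 for i >= r; both equations follow with sigma = - D(l). *)
theory Submission
  imports Defs
begin

text \<open>\<open>p\<close> is a potential: an edge towards \<open>c\<close> weighs exactly the
  drop of \<open>p\<close> along it. An edge away from \<open>c\<close> weighs at most that, since
  \<open>cyc\<close> says that no two-cycle has positive weight. Telescoping bounds every walk of
  length \<open>n\<close>.\<close>

lemma mp_power_A_mat_le_potential:
  fixes p :: "int \<Rightarrow> real"
  assumes cyc: "\<And>i. g i + g (i + 1) \<le> k"
    and step: "\<And>i. p (i + 1) = p i + (if c \<le> i then g (i + 1) else k - g i)"
  shows "mp_power (A_mat k g) n i c \<le> ereal (p i - p c)"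
proof (induction n arbitrary: i)
  case 0
  show ?case by (simp add: mp_id_def)
next
  case (Suc n)
  have "A_mat k g i m + mp_power (A_mat k g) n m c \<le> ereal (p i - p c)" for m
  proof -
    have up: "g i - k + (p (i + 1) - p c) \<le> p i - p c"
      using cyc[of i] step[of i] by (auto split: if_splits)
    have down: "g i + (p (i - 1) - p c) \<le> p i - p c"
      using cyc[of "i - 1"] step[of "i - 1"] by (auto split: if_splits)
    consider "m = i + 1" | "m = i - 1" | "m \<noteq> i + 1" "m \<noteq> i - 1" by blast
    then show ?thesis
    proof cases
      case 1
      have "A_mat k g i m + mp_power (A_mat k g) n m c \<le> ereal (g i - k) + ereal (p (i + 1) - p c)"
        unfolding 1 by (intro add_mono Suc.IH) (simp add: A_mat_def)
      also have "\<dots> \<le> ereal (p i - p c)" using up by simp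
      finally show ?thesis .
    next
      case 2
      have "A_mat k g i m + mp_power (A_mat k g) n m c \<le> ereal (g i) + ereal (p (i - 1) - p c)"
        unfolding 2 by (intro add_mono Suc.IH) (simp add: A_mat_def)
      also have "\<dots> \<le> ereal (p i - p c)" using down by simp
      finally show ?thesis .
    next
      case 3
      then have "A_mat k g i m = - \<infinity>" by (simp add: A_mat_def)
      \<comment> \<open>In \<open>ereal\<close>, -\<infinity> plus \<infinity> is \<infinity>, so
        the second summand must be known to differ from \<infinity>.\<close>
      moreover have "mp_power (A_mat k g) n m c \<noteq> \<infinity>"
        using Suc.IH[of m] by auto
      ultimately show ?thesis by (cases "mp_power (A_mat k g) n m c") auto
    qed
  qed
  then show ?case by (auto simp: mp_mult_def intro: SUP_least)
qed

text \<open>The straight path to \<open>c\<close> attains the bound: each step away from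
  \<open>c\<close> prepends one edge whose weight is the potential difference.\<close>

lemma mp_power_A_mat_ge_potential:
  fixes p :: "int \<Rightarrow> real"
  assumes step: "\<And>i. p (i + 1) = p i + (if c \<le> i then g (i + 1) else k - g i)"
  shows "\<exists>n. ereal (p i - p c) \<le> mp_power (A_mat k g) n i c"
proof (induction i rule: int_induct[where k = c])
  case base
  have "ereal (p c - p c) \<le> mp_power (A_mat k g) 0 c c" by (simp add: mp_id_def)
  then show ?case ..
next
  case (step1 i)
  then obtain n where n: "ereal (p i - p c) \<le> mp_power (A_mat k g) n i c" by blast
  have "ereal (p (i + 1) - p c) = A_mat k g (i + 1) i + ereal (p i - p c)"
    using step[of i] step1 by (simp add: A_mat_def)
  also have "\<dots> \<le> A_mat k g (i + 1) i + mp_power (A_mat k g) n i c"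
    by (intro add_mono n order_refl)
  also have "\<dots> \<le> mp_power (A_mat k g) (Suc n) (i + 1) c"
    by (auto simp: mp_mult_def intro: SUP_upper)
  finally show ?case ..
next
  case (step2 i)
  then obtain n where n: "ereal (p i - p c) \<le> mp_power (A_mat k g) n i c" by blast
  have "ereal (p (i - 1) - p c) = A_mat k g (i - 1) i + ereal (p i - p c)"
    using step[of "i - 1"] step2 by (simp add: A_mat_def)
  also have "\<dots> \<le> A_mat k g (i - 1) i + mp_power (A_mat k g) n i c"
    by (intro add_mono n order_refl)
  also have "\<dots> \<le> mp_power (A_mat k g) (Suc n) (i - 1) c"
    by (auto simp: mp_mult_def intro: SUP_upper)
  finally show ?case ..
qed

lemma kleene_star_A_mat_eq_potential:
  fixes p :: "int \<Rightarrow> real"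
  assumes "\<And>i. g i + g (i + 1) \<le> k"
    and "\<And>i. p (i + 1) = p i + (if c \<le> i then g (i + 1) else k - g i)"
  shows "kleene_star (A_mat k g) i c = ereal (p i - p c)"
  unfolding kleene_star_def
proof (rule antisym)
  show "(SUP n. mp_power (A_mat k g) n i c) \<le> ereal (p i - p c)"
    by (intro SUP_least mp_power_A_mat_le_potential assms)
  show "ereal (p i - p c) \<le> (SUP n. mp_power (A_mat k g) n i c)"
    using mp_power_A_mat_ge_potential[of p c g k i, OF assms(2)]
    by (auto intro: SUP_upper2)
qed

lemma shift_to_zero_kleene_column:
  assumes cyc: "\<And>i. g i + g (i + 1) \<le> k" and zero: "\<And>i. N \<le> i \<Longrightarrow> g i = 0"
  obtains p :: "int \<Rightarrow> real"
  where "\<And>i. p (i + 1) = p i + (if c \<le> i then g (i + 1) else k - g i)"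
    and "\<And>i. max N c \<le> i \<Longrightarrow> p i = 0"
    and "\<And>i. shift_to_zero (\<lambda>i. kleene_star (A_mat k g) i c) i = ereal (p i)"
proof -
  define d where "d i = (if c \<le> i then g (i + 1) else k - g i)" for i
  define M where "M = max N c"
  \<comment> \<open>Summing the increments \<open>d\<close> from the right end makes
    \<open>p\<close> vanish from \<open>M\<close> on, where the sum is empty and the increments
    \<open>g (i + 1)\<close> are 0.\<close>
  define p where "p i = - (\<Sum>m = i..<M. d m)" for i
  have step: "p (i + 1) = p i + (if c \<le> i then g (i + 1) else k - g i)" for i
  proof (cases "i < M")
    case True
    then have "{i..<M} = insert i {i + 1..<M}" by auto
    then have "p i = p (i + 1) - d i" by (simp add: p_def)
    then show ?thesis by (simp add: d_def)
  next
    case False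
    then have "N \<le> i + 1" "c \<le> i" by (auto simp: M_def)
    then show ?thesis using zero[of "i + 1"] False by (simp add: p_def)
  qed
  have vanish: "p i = 0" if "max N c \<le> i" for i
    using that by (simp add: p_def M_def)
  have "shift_to_zero (\<lambda>i. kleene_star (A_mat k g) i c) = (\<lambda>i. ereal (p i))"
  proof (rule shift_to_zero_eqI)
    show "ereal (p i) = kleene_star (A_mat k g) i c + ereal (p c)" for i
      by (simp add: kleene_star_A_mat_eq_potential[OF cyc step])
    show "ereal (p i) = 0" if "max N c \<le> i" for i
      using vanish[OF that] by simp
  qed
  then show thesis using that[OF step vanish] by simp
qed

text \<open>The terms are at most \<open>u i\<close> and \<open>1 - u i\<close>. For
  \<open>k = 1\<close> this is the two-cycle bound.\<close>

lemma gam_consecutive_le: "gam u i + gam u (i + 1) \<le> 1"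
  by (simp add: gam_def)

lemma del_consecutive_le: "del u i + del u (i + 1) \<le> 1"
  by (simp add: del_def)

lemma finite_support_bounds:
  fixes u :: "int \<Rightarrow> real"
  assumes "finite {i. u i \<noteq> 0}"
  obtains N where "\<And>i. \<bar>i\<bar> \<ge> N \<Longrightarrow> u i = 0"
proof -
  have fin: "finite (abs ` {i. u i \<noteq> 0})" using assms by simp
  show thesis
  proof (rule that)
    fix i :: int assume i: "\<bar>i\<bar> \<ge> Max (abs ` {i. u i \<noteq> 0}) + 1"
    show "u i = 0"
    proof (rule ccontr)
      assume "u i \<noteq> 0"
      then have "\<bar>i\<bar> \<le> Max (abs ` {i. u i \<noteq> 0})" by (intro Max_ge fin) auto
      with i show False by simp
    qed
  qed
qed

text \<open>The pair (i, i+1) extends to a maximal run of pairs with sum at least 1; the run ends on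
  both sides because \<open>u\<close> vanishes far out.\<close>

lemma soliton_containing:
  assumes fin: "finite {i. u i \<noteq> 0}" and i: "u i + u (i + 1) \<ge> 1"
  obtains l s where "soliton u l s" "l \<le> i" "i < l + int s"
proof -
  obtain N where N: "\<And>i. \<bar>i\<bar> \<ge> N \<Longrightarrow> u i = 0"
    using finite_support_bounds[OF fin] by blast
  \<comment> \<open>\<open>a\<close> and \<open>b\<close> will count the further pairs of the run to
    the left and right of (i, i+1). The run goes from i - a to i + b + 1, hence the length parameter
    \<open>a + b + 1\<close>.\<close>
  define L where "L n \<longleftrightarrow> u (i - int n - 1) + u (i - int n) < 1" for n
  define R where "R n \<longleftrightarrow> u (i + int n + 1) + u (i + int n + 2) < 1" for n
  define a where "a = (LEAST n. L n)"
  define b where "b = (LEAST n. R n)"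
  have "L (nat (\<bar>N\<bar> + \<bar>i\<bar>))" "R (nat (\<bar>N\<bar> + \<bar>i\<bar>))"
    by (simp_all add: L_def R_def N)
  then have La: "L a" and Rb: "R b"
    unfolding a_def b_def by (blast intro: LeastI)+
  have before: "\<not> L n" if "n < a" for n
    using that not_less_Least unfolding a_def by blast
  have after: "\<not> R n" if "n < b" for n
    using that not_less_Least unfolding b_def by blast
  show thesis
  proof (rule that)
    show "soliton u (i - int a) (a + b + 1)"
      unfolding soliton_def
    proof (intro conjI allI impI)
      fix j assume j: "j < a + b + 1"
      consider "j < a" | "j = a" | "a < j" by linarith
      then show "u (i - int a + int j) + u (i - int a + int j + 1) \<ge> 1"
      proof cases
        case 1
        then have eq: "i - int a + int j = i - int (a - j - 1) - 1"
          "i - int (a - j - 1) - 1 + 1 = i - int (a - j - 1)" by auto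
        show ?thesis using before[of "a - j - 1"] 1 unfolding eq L_def by linarith
      next
        case 2
        then show ?thesis using i by simp
      next
        case 3
        then have eq: "i - int a + int j = i + int (j - a - 1) + 1"
          "i + int (j - a - 1) + 1 + 1 = i + int (j - a - 1) + 2" by auto
        show ?thesis using after[of "j - a - 1"] 3 j unfolding eq R_def by linarith
      qed
    qed (use La Rb in \<open>auto simp: L_def R_def algebra_simps\<close>)
  qed auto
qed

theorem theorem3p2:
  fixes u :: "int \<Rightarrow> real" and k :: real and l :: int and s :: nat
  assumes "finite {i. u i \<noteq> 0}"
    and "case_C2 u"
    and "k = 1"
    and "soliton u l s"
    and "\<And>l' s'. soliton u l' s' \<Longrightarrow> l' = l \<and> s' = s"
  shows "\<exists>\<sigma>::real. \<forall>i.
    Phi1 k u l i = max (Phi2 k u l s (i + 1)) (Phi1 k u l (i + 1) + ereal (u i - 1)) \<and>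
    Phi2 k u l s (i + 1) = max (Phi1 k u l i - ereal \<sigma>) (Phi2 k u l s i + ereal (u i + k - 1))"
proof -
  define r where "r = l + int s"
  have lr: "l < r" using assms(4) by (simp add: soliton_def r_def)
  have inside: "u i + u (i + 1) \<ge> 1" if "l \<le> i" "i < r" for i
  proof -
    have "nat (i - l) < s" using that by (simp add: r_def)
    with assms(4) have "u (l + int (nat (i - l))) + u (l + int (nat (i - l)) + 1) \<ge> 1"
      unfolding soliton_def by blast
    with that show ?thesis by simp
  qed
  \<comment> \<open>A pair with sum at least 1 lies in some soliton, and by uniqueness this is (l,
    ..., r).\<close>
  have outside: "u i + u (i + 1) < 1" if "i < l \<or> r \<le> i" for i
  proof (rule ccontr)
    assume "\<not> ?thesis"
    then have ge: "u i + u (i + 1) \<ge> 1" by simp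
    obtain l' s' where sol: "soliton u l' s'" and "l' \<le> i" "i < l' + int s'"
      by (rule soliton_containing[OF assms(1) ge]) (rule that)
    moreover have "l' = l" "s' = s" using assms(5)[OF sol] by simp_all
    ultimately show False using that by (simp add: r_def)
  qed
  \<comment> \<open>Both minima at \<open>i\<close> are decided by the same comparison of u(i-1) +
    u(i) with 1.\<close>
  have gam_in: "gam u i = 1 - u (i - 1)" and del_in: "del u i = 1 - u i" if "l < i" "i \<le> r" for i
  proof -
    have "u (i - 1) + u i \<ge> 1" using inside[of "i - 1"] that by simp
    then show "gam u i = 1 - u (i - 1)" "del u i = 1 - u i"
      unfolding gam_def del_def by linarith+
  qed
  have gam_out: "gam u i = u i" and del_out: "del u i = u (i - 1)" if "i \<le> l \<or> r < i" for i
  proof -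
    have "i - 1 < l \<or> r \<le> i - 1" using that by linarith
    then have "u (i - 1) + u i < 1" using outside[of "i - 1"] by simp
    then show "gam u i = u i" "del u i = u (i - 1)"
      unfolding gam_def del_def by linarith+
  qed
  obtain N where N: "\<And>i. \<bar>i\<bar> \<ge> N \<Longrightarrow> u i = 0"
    using finite_support_bounds[OF assms(1)] by blast
  \<comment> \<open>The extra 1 covers the term \<open>u (i - 1)\<close>.\<close>
  have zero: "gam u i = 0" "del u i = 0" if "\<bar>N\<bar> + 1 \<le> i" for i
    using that by (simp_all add: gam_def del_def N)
  obtain P where P_step: "\<And>i. P (i + 1) = P i + (if l \<le> i then gam u (i + 1) else 1 - gam u i)"
    and P_zero: "\<And>i. max (\<bar>N\<bar> + 1) l \<le> i \<Longrightarrow> P i = 0"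
    and P_star: "\<And>i. shift_to_zero (\<lambda>i. kleene_star (A_mat 1 (gam u)) i l) i = ereal (P i)"
    by (rule shift_to_zero_kleene_column[of "gam u" 1 "\<bar>N\<bar> + 1" l, OF gam_consecutive_le zero(1)])
      (assumption, rule that)
  have P: "Phi1 k u l i = ereal (P i)" for i
    using P_star by (simp add: Phi1_def assms(3))
  obtain Q where Q_step: "\<And>i. Q (i + 1) = Q i + (if r \<le> i then del u (i + 1) else 1 - del u i)"
    and Q_zero: "\<And>i. max (\<bar>N\<bar> + 1) r \<le> i \<Longrightarrow> Q i = 0"
    and Q_star: "\<And>i. shift_to_zero (\<lambda>i. kleene_star (A_mat 1 (del u)) i r) i = ereal (Q i)"
    by (rule shift_to_zero_kleene_column[of "del u" 1 "\<bar>N\<bar> + 1" r, OF del_consecutive_le zero(2)])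
      (assumption, rule that)
  have Q: "Phi2 k u l s i = ereal (Q i)" for i
    using Q_star by (simp add: Phi2_def r_def assms(3))
  \<comment> \<open>The increment of \<open>P\<close> switches branch at \<open>l\<close>, but
    inside the soliton \<open>gam u (i + 1)\<close> is again \<open>1 - u i\<close>, so one formula
    holds up to \<open>r\<close>. Likewise \<open>Q_right\<close> holds already right of
    \<open>l\<close>.\<close>
  have P_left: "P (i + 1) = P i + 1 - u i" if "i < r" for i
    using P_step[of i] gam_in[of "i + 1"] gam_out[of i] that by (cases "l \<le> i") auto
  have P_right: "P (i + 1) = P i + u (i + 1)" if "r \<le> i" for i
    using P_step[of i] gam_out[of "i + 1"] that lr by auto
  have Q_left: "Q (i + 1) = Q i + 1 - u (i - 1)" if "i \<le> l" for i
    using Q_step[of i] del_out[of i] that lr by auto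
  have Q_right: "Q (i + 1) = Q i + u i" if "l < i" for i
    using Q_step[of i] del_in[of i] del_out[of "i + 1"] that by (cases "r \<le> i") auto
  \<comment> \<open>With this index shift the increments of \<open>Q\<close> and \<open>P\<close>
    cancel outside the soliton; inside, D(i) - D(i-1) = u(i-1) + u(i) - 1.\<close>
  define D where "D i = Q (i + 1) - P i" for i
  have D_left: "D i = D l" if "i \<le> l" for i
    using that
  proof (induction i rule: int_le_induct)
    case (step i)
    then show ?case
      using P_left[of "i - 1"] Q_left[of i] lr by (simp add: D_def)
  qed simp
  have D_right: "D i = 0" if "r \<le> i" for i
  proof -
    have const: "D (r + int n) = D r" for n
    proof (induction n)
      case (Suc n)
      then show ?case
        using P_right[of "r + int n"] Q_right[of "r + int n + 1"] lr
        by (simp add: D_def algebra_simps)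
    qed simp
    \<comment> \<open>Large enough that both \<open>P\<close> and \<open>Q\<close> have vanished,
      which fixes the constant value of \<open>D\<close> as 0.\<close>
    define m where "m = nat (\<bar>N\<bar> + 1 + \<bar>r\<bar>)"
    have "max (\<bar>N\<bar> + 1) l \<le> r + int m" "max (\<bar>N\<bar> + 1) r \<le> r + int m + 1"
      using lr unfolding m_def by linarith+
    then have "D (r + int m) = 0"
      unfolding D_def by (simp only: P_zero Q_zero diff_self)
    then have "D (r + int (nat (i - r))) = 0"
      by (simp only: const)
    then show ?thesis using that by simp
  qed
  have D_mono: "D (i - 1) \<le> D i" if "l < i" "i \<le> r" for i
    using P_left[of "i - 1"] Q_right[of i] inside[of "i - 1"] that by (simp add: D_def)
  have D_ge: "D l \<le> D i" if "l \<le> i" "i \<le> r" for i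
    using that
  proof (induction i rule: int_ge_induct)
    case (step i)
    then show ?case using D_mono[of "i + 1"] by simp
  qed simp
  have D_le: "D i \<le> 0" if "l \<le> i" "i \<le> r" for i
    using that(2,1)
  proof (induction i rule: int_le_induct)
    case (step i)
    then show ?case using D_mono[of i] by simp
  qed (simp add: D_right)
  have D_bounds: "D l \<le> D i \<and> D i \<le> 0" for i
  proof -
    consider "i \<le> l" | "l \<le> i" "i \<le> r" | "r \<le> i" by linarith
    then show ?thesis
    proof cases
      case 1
      then show ?thesis using D_left[of i] D_le[of l] lr by simp
    next
      case 2
      then show ?thesis using D_ge[of i] D_le[of i] by simp
    next
      case 3
      then show ?thesis using D_right[of i] D_le[of l] lr by simp
    qed
  qed
  \<comment> \<open>For i < r the second term equals P(i) and D(i) \<le> 0 bounds the first. For i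
    \<ge> r the first equals P(i), and the second is P(i) + u(i) + u(i+1) - 1, which is
    smaller.\<close>
  have P_eq: "P i = max (Q (i + 1)) (P (i + 1) + (u i - 1))" for i
  proof (cases "i < r")
    case True
    then show ?thesis using P_left[of i] D_bounds[of i] by (simp add: D_def)
  next
    case False
    then show ?thesis
      using P_right[of i] D_right[of i] outside[of i] by (simp add: D_def)
  qed
  \<comment> \<open>Here the switch is at \<open>l\<close>: up to \<open>l\<close> the first term is
    attained because D(i) = D(l), beyond it the second is attained and D(l) \<le> D(i) bounds the
    first.\<close>
  have Q_eq: "Q (i + 1) = max (P i + D l) (Q i + u i)" for i
  proof (cases "i \<le> l")
    case True
    then show ?thesis
      using Q_left[of i] D_left[of i] outside[of "i - 1"] by (simp add: D_def)
  next
    case False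
    then show ?thesis using Q_right[of i] D_bounds[of i] by (simp add: D_def)
  qed
  have "Phi1 k u l i = max (Phi2 k u l s (i + 1)) (Phi1 k u l (i + 1) + ereal (u i - 1))" for i
    unfolding P Q using arg_cong[OF P_eq[of i], of ereal] by simp
  moreover have "Phi2 k u l s (i + 1) =
      max (Phi1 k u l i - ereal (- D l)) (Phi2 k u l s i + ereal (u i + k - 1))" for i
    unfolding P Q using arg_cong[OF Q_eq[of i], of ereal] assms(3) by simp
  ultimately show ?thesis by blast
qed

end
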